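(* Let $X=\prod_{i=1}^n\{0,\dots,m_i\}$, $f\colon X\to X$, and $f^b=\beta\circ f\circ\beta^{-1}\colon\mathcal{A}\to\mathcal{A}$. Suppose that the asynchronous dynamics $AD_f$ admits a cyclic attractor $C$. Then the graph $G_{f^b}(\beta(C))$ contains a negative cycle.
   Context: $m_i\ge1$, $m=\sum_i m_i$; coordinates of $\{0,1\}^m$ are indexed by $I=\{(i,j)\mid 1\le i\le n,\,1\le j\le m_i\}$. $\beta\colon X\to\{0,1\}^m$ is given by $\beta_{i,j}(x)=1$ iff $x_i\ge j$; $\mathcal{A}=\beta(X)$. $e^k$ is the $k$-th unit vector, $\mathrm{sign}(0)=0$. The asynchronous dynamics $AD_f$ is the directed graph on $X$ with an edge $(x,x+se^i)$ whenever $s=\mathrm{sign}(f_i(x)-x_i)\ne0$. A nonempty $T\subseteq X$ is a trap set if every edge leaving a state of $T$ ends in $T$; attractors are the inclusion-minimal trap sets; an attractor is cyclic if it has more than one state. For a map $g\colon Y\to Y$, $Y$ a set of integer vectors with coordinates indexed by a finite set $J$, the local interaction graph $G_g(z)$ at $z\in Y$ has vertex set $J$ and an edge from $j$ to $i$ with sign $s_1\,\mathrm{sign}(g_i(z+s_1e^j)-g_i(z))$ whenever $s_1\in\{-1,1\}$, $z+s_1e^j\in Y$ and this sign is nonzero. For $S\subseteq Y$, $G_g(S)$ is the signed graph on $J$ containing an edge $j\to i$ of sign $s$ iff $G_g(z)$ contains it for some $z\in S$. Cycles are elementary directed cycles (loops allowed), with sign the product of edge signs. *)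

theory Defs
  imports "HOL-Library.FuncSet" "Graph_Theory.Graph_Theory"
begin

text \<open>
  Integer vectors with coordinates indexed by a finite set \<open>J\<close> are functions in
  \<open>extensional J\<close>.
\<close>

type_synonym 'j ivec = "'j \<Rightarrow> int"

text \<open>The vector \<open>z + s e\<^sup>j\<close>, for \<open>j\<close> in the index set.\<close>

definition shift :: "'j ivec \<Rightarrow> int \<Rightarrow> 'j \<Rightarrow> 'j ivec" where
  "shift z s j = z(j := z j + s)"

definition states :: "nat \<Rightarrow> (nat \<Rightarrow> nat) \<Rightarrow> nat ivec set" where
  "states n m = (\<Pi>\<^sub>E i\<in>{1..n}. {0..int (m i)})"

definition bool_index :: "nat \<Rightarrow> (nat \<Rightarrow> nat) \<Rightarrow> (nat \<times> nat) set" where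
  "bool_index n m = {(i, j). 1 \<le> i \<and> i \<le> n \<and> 1 \<le> j \<and> j \<le> m i}"

definition beta :: "nat \<Rightarrow> (nat \<Rightarrow> nat) \<Rightarrow> nat ivec \<Rightarrow> (nat \<times> nat) ivec" where
  "beta n m x = (\<lambda>(i, j)\<in>bool_index n m. if x i \<ge> int j then 1 else 0)"

definition admissible :: "nat \<Rightarrow> (nat \<Rightarrow> nat) \<Rightarrow> (nat \<times> nat) ivec set" where
  "admissible n m = beta n m ` states n m"

text \<open>Only the values on \<open>admissible n m\<close> are meaningful.\<close>

definition bool_map ::
    "nat \<Rightarrow> (nat \<Rightarrow> nat) \<Rightarrow> (nat ivec \<Rightarrow> nat ivec) \<Rightarrow> (nat \<times> nat) ivec \<Rightarrow> (nat \<times> nat) ivec" where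
  "bool_map n m f = beta n m \<circ> f \<circ> the_inv_into (states n m) (beta n m)"

lemma inj_on_beta: "inj_on (beta n m) (states n m)"
proof (rule inj_onI)
  fix x y assume x: "x \<in> states n m" and y: "y \<in> states n m" and e: "beta n m x = beta n m y"
  have le: "u i \<le> v i"
    if "u \<in> states n m" "v \<in> states n m" "beta n m u = beta n m v" "i \<in> {1..n}" for u v i
  proof (rule ccontr)
    assume "\<not> u i \<le> v i"
    moreover have u: "0 \<le> u i" "u i \<le> int (m i)" and v: "0 \<le> v i"
      using that by (auto simp: states_def PiE_iff)
    ultimately have "(i, nat (u i)) \<in> bool_index n m"
      using that(4) by (auto simp: bool_index_def)
    with fun_cong[OF that(3), of "(i, nat (u i))"] u \<open>\<not> u i \<le> v i\<close> show False
      by (simp add: beta_def)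
  qed
  show "x = y"
    using x y le[OF x y e] le[OF y x e[symmetric]]
    by (intro PiE_ext[of x "{1..n}" _ y]) (auto simp: states_def intro!: antisym)
qed

definition async_dynamics ::
    "nat \<Rightarrow> (nat \<Rightarrow> nat) \<Rightarrow> (nat ivec \<Rightarrow> nat ivec) \<Rightarrow> nat ivec pair_pre_digraph" where
  "async_dynamics n m f =
    \<lparr> pverts = states n m,
      parcs = {(x, shift x s i) | x s i.
        x \<in> states n m \<and> i \<in> {1..n} \<and> s = sgn (f x i - x i) \<and> s \<noteq> 0} \<rparr>"

definition trap_set :: "'a pair_pre_digraph \<Rightarrow> 'a set \<Rightarrow> bool" where
  "trap_set G T \<longleftrightarrow> T \<noteq> {} \<and> T \<subseteq> pverts G \<and> (\<forall>(x, y)\<in>parcs G. x \<in> T \<longrightarrow> y \<in> T)"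

definition attractor :: "'a pair_pre_digraph \<Rightarrow> 'a set \<Rightarrow> bool" where
  "attractor G C \<longleftrightarrow> trap_set G C \<and> (\<forall>T. trap_set G T \<and> T \<subseteq> C \<longrightarrow> T = C)"

definition cyclic_attractor :: "'a pair_pre_digraph \<Rightarrow> 'a set \<Rightarrow> bool" where
  "cyclic_attractor G C \<longleftrightarrow> attractor G C \<and> (\<exists>x\<in>C. \<exists>y\<in>C. x \<noteq> y)"

text \<open>
  An edge from \<open>j\<close> to \<open>i\<close> of sign \<open>s\<close> is the triple \<open>(j, s, i)\<close>, so that parallel
  edges of opposite signs are possible.
\<close>

type_synonym 'j signed_edge = "'j \<times> int \<times> 'j"

abbreviation edge_sign :: "'j signed_edge \<Rightarrow> int" where
  "edge_sign e \<equiv> fst (snd e)"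

definition signed_graph ::
    "'j set \<Rightarrow> 'j signed_edge set \<Rightarrow> ('j, 'j signed_edge) pre_digraph" where
  "signed_graph J E = \<lparr> verts = J, arcs = E, tail = fst, head = snd \<circ> snd \<rparr>"

definition local_interaction_graph ::
    "'j set \<Rightarrow> 'j ivec set \<Rightarrow> ('j ivec \<Rightarrow> 'j ivec) \<Rightarrow> 'j ivec \<Rightarrow> ('j, 'j signed_edge) pre_digraph"
  where
  "local_interaction_graph J Y g z = signed_graph J
    {(j, s * sgn (g (shift z s j) i - g z i), i) | j s i.
       j \<in> J \<and> i \<in> J \<and> s \<in> {-1, 1} \<and> shift z s j \<in> Y \<and> s * sgn (g (shift z s j) i - g z i) \<noteq> 0}"

definition interaction_graph ::
    "'j set \<Rightarrow> 'j ivec set \<Rightarrow> ('j ivec \<Rightarrow> 'j ivec) \<Rightarrow> 'j ivec set \<Rightarrow> ('j, 'j signed_edge) pre_digraph"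
  where
  "interaction_graph J Y g S =
    signed_graph J (\<Union>z\<in>S. arcs (local_interaction_graph J Y g z))"

text \<open>\<open>pre_digraph.cycle\<close> denotes elementary directed cycles, loops included.\<close>

definition negative_cycle ::
    "('j, 'j signed_edge) pre_digraph \<Rightarrow> 'j signed_edge list \<Rightarrow> bool" where
  "negative_cycle G p \<longleftrightarrow> pre_digraph.cycle G p \<and> prod_list (map edge_sign p) = -1"

end

theory Submission
  imports Defs
begin

text \<open>
  Let \<open>V\<close> be the set of thresholds that are crossed inside \<open>C\<close>. If there is no negative cycle, a
  minimal nonempty subset \<open>S\<close> of \<open>V\<close> closed under predecessors in \<open>V\<close> is strongly connected, hence
  balanced: there are signs \<open>\<sigma>\<close> such that every edge \<open>u \<rightarrow> v\<close> from \<open>V\<close> to \<open>S\<close> has \<open>u \<in> S\<close> and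
  sign \<open>\<sigma> u * \<sigma> v\<close>. Moves that cross no threshold of \<open>S\<close> do not influence the targets of \<open>S\<close>, and
  the targets of \<open>S\<close> are monotone in the order twisted by \<open>\<sigma>\<close>. By induction on boxes, every state
  of \<open>C\<close> leads to one where all thresholds of \<open>S\<close> agree with their targets. Such states form a
  trap set, which is \<open>C\<close> by minimality; so the thresholds of \<open>S\<close> are never crossed in \<open>C\<close>, although
  \<open>S \<subseteq> V\<close>.
\<close>

section \<open>Boolean coordinates read as thresholds of integer states\<close>

definition level :: "nat ivec \<Rightarrow> nat \<times> nat \<Rightarrow> int" where
  "level x v = of_bool (int (snd v) \<le> x (fst v))"

lemma beta_eq_level: "v \<in> bool_index n m \<Longrightarrow> beta n m x v = level x v"
  by (auto simp: beta_def level_def split: prod.splits)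

lemma finite_bool_index: "finite (bool_index n m)"
proof -
  have "bool_index n m = (SIGMA i:{1..n}. {1..m i})"
    by (auto simp: bool_index_def)
  then show ?thesis by simp
qed

section \<open>Balanced predecessor-closed sets of vertices\<close>

lemma prod_list_signs:
  fixes xs :: "int list"
  shows "set xs \<subseteq> {-1, 1} \<Longrightarrow> prod_list xs \<in> {-1, 1}"
  by (induction xs) auto

text \<open>A repeated vertex splits a closed walk into two shorter closed walks whose signs
  multiply to -1, so one of them is again negative; induction on the length ends in an elementary
  cycle.\<close>

lemma (in wf_digraph) negative_closed_walk_imp_negative_cycle:
  fixes sg :: "'b \<Rightarrow> int"
  assumes sg: "\<And>e. e \<in> arcs G \<Longrightarrow> sg e \<in> {-1, 1}"
    and "awalk u p u" "prod_list (map sg p) = -1"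
  shows "\<exists>q. cycle q \<and> prod_list (map sg q) = -1"
  using assms(2,3)
proof (induction "length p" arbitrary: u p rule: less_induct)
  case less
  then obtain e es where p: "p = e # es" by (cases p) auto
  show ?case
  proof (cases "distinct (tl (awalk_verts u p))")
    case True
    with less.prems p show ?thesis unfolding cycle_def by blast
  next
    case False
    \<comment> \<open>The tail of the vertex list of \<open>e # es\<close> is the vertex list of
      \<open>es\<close>, so the loop \<open>r\<close> is cut out of \<open>es\<close> and is shorter
      than \<open>p\<close>.\<close>
    have w: "awalk (head G e) es u" "e \<in> arcs G" "u = tail G e"
      using less.prems p by (auto simp: awalk_Cons_iff)
    from False p awalk_not_distinct_decomp[OF w(1)] obtain q r s v where
      es: "es = q @ r @ s" and r: "r \<noteq> []"
      and v: "awalk (head G e) q v" "awalk v r v" "awalk v s u"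
      by auto
    have "set (map sg r) \<subseteq> {-1, 1}"
      using v(2) sg by (auto simp: awalk_def)
    then consider "prod_list (map sg r) = -1" | "prod_list (map sg r) = 1"
      using prod_list_signs by blast
    then show ?thesis
    proof cases
      case 1
      show ?thesis by (rule less.hyps[OF _ v(2) 1]) (simp add: p es)
    next
      case 2
      have "awalk u (e # q @ s) u"
        using awalk_appendI[OF v(1,3)] w by (simp add: awalk_Cons_iff)
      moreover have "prod_list (map sg (e # q @ s)) = -1"
        using less.prems(2) 2 by (simp add: p es)
      ultimately show ?thesis
        using r by (intro less.hyps[of "e # q @ s" u]) (auto simp: p es)
    qed
  qed
qed

text \<open>Take a vertex \<open>r\<close> with the fewest ancestors. Each ancestor of
  \<open>r\<close> then has the same ancestors as \<open>r\<close>, so this set is strongly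
  connected and closed under predecessors. Closed walks have sign 1, so the sign of a walk from
  \<open>r\<close> depends only on its end; this sign is \<sigma>.\<close>

lemma (in wf_digraph) exists_balanced_predecessor_closed:
  fixes sg :: "'b \<Rightarrow> int"
  assumes fin: "finite (verts G)" and ne: "verts G \<noteq> {}"
    and sg: "\<And>e. e \<in> arcs G \<Longrightarrow> sg e \<in> {-1, 1}"
    and no_neg: "\<nexists>p. cycle p \<and> prod_list (map sg p) = -1"
  obtains S \<sigma> where "S \<subseteq> verts G" "S \<noteq> {}" "\<And>v. v \<in> S \<Longrightarrow> \<sigma> v \<in> {-1, 1 :: int}"
    "\<And>e. e \<in> arcs G \<Longrightarrow> head G e \<in> S \<Longrightarrow> tail G e \<in> S \<and> sg e = \<sigma> (tail G e) * \<sigma> (head G e)"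
proof -
  define A where "A v = {u. \<exists>p. awalk u p v}" for v
  have A_verts: "A v \<subseteq> verts G" for v by (auto simp: A_def awalk_def)
  have A_mono: "A u \<subseteq> A v" if "u \<in> A v" for u v
    using that by (auto simp: A_def intro: awalk_appendI)
  have A_refl: "v \<in> A v" if "v \<in> verts G" for v
    using that by (auto simp: A_def awalk_Nil_iff intro!: exI[of _ "[]"])
  obtain r where r: "r \<in> verts G" "\<And>v. v \<in> verts G \<Longrightarrow> card (A r) \<le> card (A v)"
    using ne ex_has_least_nat[of "\<lambda>v. v \<in> verts G" _ "\<lambda>v. card (A v)"] by blast
  have "A u = A r" if "u \<in> A r" for u
    using that A_verts r(2)[of u] A_mono[OF that] finite_subset[OF A_verts fin]
    by (metis card_seteq subsetD)
  then have to: "\<exists>p. awalk r p u" if "u \<in> A r" for u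
    using that A_refl[OF r(1)] by (auto simp: A_def)
  define P where "P u = (SOME p. awalk r p u)" for u
  have P: "awalk r (P u) u" if "u \<in> A r" for u
    unfolding P_def using someI_ex[OF to[OF that]] .
  define \<sigma> where "\<sigma> u = prod_list (map sg (P u))" for u
  have signs: "prod_list (map sg p) \<in> {-1, 1}" if "awalk u p v" for u p v
    by (rule prod_list_signs) (use that sg in \<open>auto simp: awalk_def\<close>)
  have closed: "prod_list (map sg p) = 1" if "awalk u p u" for u p
    using negative_closed_walk_imp_negative_cycle[of sg, OF sg that] no_neg signs[OF that] by blast
  show ?thesis
  proof (rule that[of "A r" \<sigma>])
    show "A r \<subseteq> verts G" by (rule A_verts)
    show "A r \<noteq> {}" using A_refl[OF r(1)] by auto
    show "\<sigma> v \<in> {-1, 1}" if "v \<in> A r" for v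
      unfolding \<sigma>_def by (rule signs[OF P[OF that]])
    \<comment> \<open>A walk \<open>q\<close> from the head of \<open>e\<close> back to
      \<open>r\<close> closes both the chosen walk to the head and the chosen walk to the tail
      prolonged by \<open>e\<close>. Comparing the two signs gives the factorisation of
      \<open>sg e\<close>.\<close>
    fix e assume e: "e \<in> arcs G" and hd: "head G e \<in> A r"
    then obtain q where q: "awalk (head G e) q r" by (auto simp: A_def)
    have eq: "awalk (tail G e) (e # q) r" using e q by (simp add: awalk_Cons_iff)
    then have tl: "tail G e \<in> A r" by (auto simp: A_def)
    have "\<sigma> (head G e) * prod_list (map sg q) = 1"
      using closed[OF awalk_appendI[OF P[OF hd] q]] by (simp add: \<sigma>_def)
    moreover have "\<sigma> (tail G e) * (sg e * prod_list (map sg q)) = 1"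
      using closed[OF awalk_appendI[OF P[OF tl] eq]] by (simp add: \<sigma>_def)
    moreover have "\<sigma> (head G e) \<in> {-1, 1}" "\<sigma> (tail G e) \<in> {-1, 1}" "sg e \<in> {-1, 1}"
      using signs[OF P[OF hd]] signs[OF P[OF tl]] sg[OF e] by (simp_all add: \<sigma>_def)
    ultimately show "tail G e \<in> A r \<and> sg e = \<sigma> (tail G e) * \<sigma> (head G e)"
      using tl by auto
  qed
qed

section \<open>Trap sets with a balanced set of thresholds\<close>

text \<open>A move from \<open>x\<close> to \<open>y\<close> in coordinate \<open>i\<close> crosses the threshold \<open>(i, nat (max (x i) (y i)))\<close>.\<close>

locale balanced_trap =
  fixes n :: nat and m :: "nat \<Rightarrow> nat" and f :: "nat ivec \<Rightarrow> nat ivec"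
    and C :: "nat ivec set" and S :: "(nat \<times> nat) set" and \<sigma> :: "nat \<times> nat \<Rightarrow> int"
  assumes C_states: "C \<subseteq> states n m"
    and C_closed: "x \<in> C \<Longrightarrow> (x, y) \<in> parcs (async_dynamics n m f) \<Longrightarrow> y \<in> C"
    and S_index: "S \<subseteq> bool_index n m"
    and sigma: "v \<in> S \<Longrightarrow> \<sigma> v \<in> {-1, 1}"
    and balanced: "\<lbrakk>x \<in> C; i \<in> {1..n}; s = sgn (f x i - x i); s \<noteq> 0; y = shift x s i; v \<in> S;
      level (f y) v \<noteq> level (f x) v\<rbrakk> \<Longrightarrow> (i, nat (max (x i) (y i))) \<in> S \<and>
        s * sgn (level (f y) v - level (f x) v) = \<sigma> (i, nat (max (x i) (y i))) * \<sigma> v"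
begin

definition box :: "nat ivec \<Rightarrow> nat ivec \<Rightarrow> nat ivec set" where
  "box a b = {x. \<forall>i\<in>{1..n}. a i \<le> x i \<and> x i \<le> b i}"

definition box_step :: "nat ivec \<Rightarrow> nat ivec \<Rightarrow> nat ivec \<Rightarrow> nat ivec \<Rightarrow> bool" where
  "box_step a b x y \<longleftrightarrow> (x, y) \<in> parcs (async_dynamics n m f) \<and> y \<in> box a b"

text \<open>These are the thresholds in \<open>S\<close> that a move inside the box can cross.
  Threshold \<open>j\<close> separates \<open>j - 1\<close> from \<open>j\<close>, hence the strict
  lower and the weak upper bound.\<close>

definition thresholds :: "nat ivec \<Rightarrow> nat ivec \<Rightarrow> (nat \<times> nat) set" where
  "thresholds a b = {(i, j) \<in> S. a i < int j \<and> int j \<le> b i}"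

definition settled :: "nat ivec \<Rightarrow> nat ivec \<Rightarrow> nat ivec \<Rightarrow> bool" where
  "settled a b x \<longleftrightarrow> (\<forall>v\<in>thresholds a b. level (f x) v = level x v)"

text \<open>In the order twisted by \<sigma>, no threshold wants to rise. The global sign \<tau>
  covers the reversed order as well.\<close>

definition dominated :: "int \<Rightarrow> nat ivec \<Rightarrow> nat ivec \<Rightarrow> nat ivec \<Rightarrow> bool" where
  "dominated \<tau> a b x \<longleftrightarrow> (\<forall>v\<in>thresholds a b. \<tau> * \<sigma> v * level (f x) v \<le> \<tau> * \<sigma> v * level x v)"

text \<open>For signs \<tau> and \<sigma> each twisted level is at least -1, so after adding 1
  \<open>nat\<close> loses nothing.\<close>

definition rank :: "int \<Rightarrow> nat ivec \<Rightarrow> nat ivec \<Rightarrow> nat ivec \<Rightarrow> nat" where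
  "rank \<tau> a b x = (\<Sum>v\<in>thresholds a b. nat (\<tau> * \<sigma> v * level x v + 1))"

lemma finite_thresholds: "finite (thresholds a b)"
  by (rule finite_subset[OF _ finite_subset[OF S_index finite_bool_index]])
    (auto simp: thresholds_def)

lemma nonneg: "x \<in> C \<Longrightarrow> i \<in> {1..n} \<Longrightarrow> 0 \<le> x i"
  using C_states by (auto simp: states_def PiE_iff subset_iff)

text \<open>A unit move crosses a single threshold, and as it heads for \<open>f x i\<close>, the
  new level there equals the old target. The last claim is closure under predecessors: a threshold
  outside \<open>S\<close> has no influence on targets in \<open>S\<close>.\<close>

lemma step_level:
  assumes "x \<in> C" "i \<in> {1..n}" "s = sgn (f x i - x i)" "s \<noteq> 0" "y = shift x s i"
  defines "w \<equiv> (i, nat (max (x i) (y i)))"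
  shows "level y w = level (f x) w" "level y w = level x w + s"
    "\<And>v. v \<in> S \<Longrightarrow> v \<noteq> w \<Longrightarrow> level y v = level x v"
    "\<And>v. v \<in> S \<Longrightarrow> w \<notin> S \<Longrightarrow> level (f y) v = level (f x) v"
proof -
  have s: "s = 1 \<and> x i < f x i \<or> s = -1 \<and> f x i < x i"
    using assms(3,4) by (auto simp: sgn_if split: if_splits)
  have "0 \<le> x i" by (rule nonneg) fact+
  then show "level y w = level (f x) w" "level y w = level x w + s"
    using s assms(5) by (auto simp: level_def w_def shift_def)
  show "level y v = level x v" if "v \<in> S" "v \<noteq> w" for v
  proof (cases v)
    case (Pair k j)
    then have "1 \<le> j" using that S_index by (auto simp: bool_index_def)
    then show ?thesis using s assms(5) that \<open>0 \<le> x i\<close> Pair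
      by (auto simp: level_def w_def shift_def)
  qed
  show "level (f y) v = level (f x) v" if "v \<in> S" "w \<notin> S" for v
    using balanced[OF assms(1-5) that(1)] that(2) by (auto simp: w_def)
qed

lemma box_bounds: "x \<in> box a b \<Longrightarrow> i \<in> {1..n} \<Longrightarrow> a i \<le> x i \<and> x i \<le> b i"
  by (simp add: box_def)

lemma box_mono:
  assumes "a \<le> a'" "b' \<le> b"
  shows "box a' b' \<subseteq> box a b"
  using assms by (auto simp: box_def le_fun_def intro: order_trans)

lemma box_reach_C: "(box_step a b)\<^sup>*\<^sup>* x y \<Longrightarrow> x \<in> C \<Longrightarrow> y \<in> C"
  by (induction rule: rtranclp_induct) (auto simp: box_step_def C_closed)

lemma box_reach_box: "(box_step a b)\<^sup>*\<^sup>* x y \<Longrightarrow> x \<in> box a b \<Longrightarrow> y \<in> box a b"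
  by (induction rule: rtranclp_induct) (auto simp: box_step_def)

lemma box_reach_mono:
  assumes "box a b \<subseteq> box a' b'" "(box_step a b)\<^sup>*\<^sup>* x y"
  shows "(box_step a' b')\<^sup>*\<^sup>* x y"
  using assms(2) by (rule rtranclp_mono[THEN predicate2D, rotated]) (use assms(1) in \<open>auto simp: box_step_def\<close>)

lemma box_stepI:
  assumes "x \<in> C" "x \<in> box a b" "i \<in> {1..n}" "s = sgn (f x i - x i)" "s \<noteq> 0" "y = shift x s i"
    "a i \<le> y i" "y i \<le> b i"
  shows "box_step a b x y"
proof -
  have "x \<in> states n m" using assms(1) C_states by blast
  then have "(x, y) \<in> parcs (async_dynamics n m f)"
    using assms(3-6) unfolding async_dynamics_def by auto
  moreover have "y \<in> box a b"
    using assms(2,6-8) by (auto simp: box_def shift_def)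
  ultimately show ?thesis by (simp add: box_step_def)
qed

text \<open>In the order twisted by \<open>\<sigma>\<close>, a move that lowers a threshold of \<open>S\<close> lowers all targets.\<close>

lemma dominated_step:
  assumes tau: "\<tau> \<in> {-1, 1}" and dom: "dominated \<tau> a b x"
    and st: "x \<in> C" "i \<in> {1..n}" "s = sgn (f x i - x i)" "s \<noteq> 0" "y = shift x s i"
    and w: "w = (i, nat (max (x i) (y i)))" "w \<in> thresholds a b"
  shows "dominated \<tau> a b y \<and> rank \<tau> a b y < rank \<tau> a b x"
proof -
  note lv = step_level[OF st, folded w(1)]
  have wS: "w \<in> S" using w(2) by (auto simp: thresholds_def)
  have s: "s = 1 \<or> s = -1" using st(3,4) by (auto simp: sgn_if split: if_splits)
  have "\<tau> * \<sigma> w * level y w \<le> \<tau> * \<sigma> w * level x w"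
    using dom w(2) lv(1) by (auto simp: dominated_def)
  \<comment> \<open>The move brings \<open>w\<close> to its target, and domination forbids rising,
    so the twisted level falls.\<close>
  then have low: "\<tau> * \<sigma> w * s = -1"
    using lv(2) s tau sigma[OF wS] by (auto simp: algebra_simps)
  \<comment> \<open>By balance, a target that changes does so with twisted sign
    \<open>\<tau> * \<sigma> w * s\<close>, which is -1.\<close>
  have fdec: "\<tau> * \<sigma> v * level (f y) v \<le> \<tau> * \<sigma> v * level (f x) v" if "v \<in> S" for v
  proof (cases "level (f y) v = level (f x) v")
    case False
    from balanced[OF st that False] have "s * sgn (level (f y) v - level (f x) v) = \<sigma> w * \<sigma> v"
      by (simp add: w(1))
    then show ?thesis
      using False low s tau sigma[OF wS] sigma[OF that] by (auto simp: level_def)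
  qed simp
  have less: "\<tau> * \<sigma> w * level y w < \<tau> * \<sigma> w * level x w"
    using low lv(2) by (simp add: algebra_simps)
  have dec: "\<tau> * \<sigma> v * level y v \<le> \<tau> * \<sigma> v * level x v" if "v \<in> S" for v
    using less lv(3)[OF that] by (cases "v = w") auto
  have "dominated \<tau> a b y"
    unfolding dominated_def
  proof
    fix v assume v: "v \<in> thresholds a b"
    then have vS: "v \<in> S" by (auto simp: thresholds_def)
    show "\<tau> * \<sigma> v * level (f y) v \<le> \<tau> * \<sigma> v * level y v"
    proof (cases "v = w")
      case True
      then show ?thesis using fdec[OF vS] lv(1) by simp
    next
      case False
      then show ?thesis using fdec[OF vS] lv(3)[OF vS] dom v by (fastforce simp: dominated_def)
    qed
  qed
  moreover have "rank \<tau> a b y < rank \<tau> a b x"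
    unfolding rank_def
  proof (rule sum_strict_mono_ex1[OF finite_thresholds])
    show "\<forall>v\<in>thresholds a b. nat (\<tau> * \<sigma> v * level y v + 1) \<le> nat (\<tau> * \<sigma> v * level x v + 1)"
      using dec by (auto simp: thresholds_def intro!: nat_mono)
    have "- 1 \<le> \<tau> * \<sigma> w * level y w"
      using tau sigma[OF wS] by (auto simp: level_def)
    with less have "nat (\<tau> * \<sigma> w * level y w + 1) < nat (\<tau> * \<sigma> w * level x w + 1)"
      by simp
    then show "\<exists>v\<in>thresholds a b. nat (\<tau> * \<sigma> v * level y v + 1) < nat (\<tau> * \<sigma> v * level x v + 1)"
      using w(2) by blast
  qed
  ultimately show ?thesis ..
qed

text \<open>Coordinate \<open>i\<close> is moved towards its target until it crosses a threshold in
  \<open>S\<close>, which happens at \<open>(i, j)\<close> at the latest. Crossings outside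
  \<open>S\<close> preserve all hypotheses and shrink the distance to \<open>j\<close>; the first
  one in \<open>S\<close> lowers the rank.\<close>

lemma decrease_rank:
  assumes tau: "\<tau> \<in> {-1, 1}" and v: "(i, j) \<in> thresholds a b"
    and "dominated \<tau> a b x" "x \<in> C" "x \<in> box a b" "level (f x) (i, j) \<noteq> level x (i, j)"
  shows "\<exists>y. (box_step a b)\<^sup>*\<^sup>* x y \<and> dominated \<tau> a b y \<and> rank \<tau> a b y < rank \<tau> a b x"
  using assms(3-)
proof (induction "nat \<bar>x i - int j\<bar>" arbitrary: x rule: less_induct)
  case (less x)
  have vS: "(i, j) \<in> S" and j: "a i < int j" "int j \<le> b i"
    using v by (auto simp: thresholds_def)
  have i: "i \<in> {1..n}" using vS S_index by (auto simp: bool_index_def)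
  define s where "s = sgn (f x i - x i)"
  define y where "y = shift x s i"
  define w where "w = (i, nat (max (x i) (y i)))"
  have x: "a i \<le> x i" "x i \<le> b i" "0 \<le> x i"
    using less.prems(3) i nonneg[OF less.prems(2) i] by (auto simp: box_def)
  have cases: "s = 1 \<and> x i < int j \<and> y i = x i + 1 \<or> s = -1 \<and> int j \<le> x i \<and> y i = x i - 1"
    using less.prems(4)
    by (auto simp: level_def s_def y_def shift_def sgn_if of_bool_def split: if_splits)
  then have s0: "s \<noteq> 0" by auto
  \<comment> \<open>The move goes towards the far side of threshold \<open>j\<close>, which lies
    within the box.\<close>
  have yi: "a i \<le> y i" "y i \<le> b i" using cases x j by auto
  have step: "box_step a b x y"
    by (rule box_stepI[OF less.prems(2,3) i s_def s0 y_def yi])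
  have yC: "y \<in> C" and y_box: "y \<in> box a b"
    using step C_closed[OF less.prems(2)] by (auto simp: box_step_def)
  note lv = step_level[OF less.prems(2) i s_def s0 y_def, folded w_def]
  show ?case
  proof (cases "w \<in> S")
    case True
    then have "w \<in> thresholds a b"
      using cases x j by (auto simp: thresholds_def w_def)
    then show ?thesis
      using dominated_step[OF tau less.prems(1,2) i s_def s0 y_def w_def] step by blast
  next
    case False
    then have ne: "u \<noteq> w" if "u \<in> S" for u using that by blast
    have same: "level (f y) u = level (f x) u" "level y u = level x u" if "u \<in> S" for u
      using lv(3)[OF that ne[OF that]] lv(4)[OF that False] by simp_all
    \<comment> \<open>Stepping down from \<open>x i = j\<close> would increase the distance, but it
      crosses \<open>(i, j)\<close> itself, which is in \<open>S\<close>.\<close>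
    have "int j \<noteq> max (x i) (y i)" using ne[OF vS] by (auto simp: w_def)
    then have "nat \<bar>y i - int j\<bar> < nat \<bar>x i - int j\<bar>" using cases by auto
    moreover have dom: "dominated \<tau> a b y" and rank: "rank \<tau> a b y = rank \<tau> a b x"
      using less.prems(1) same by (auto simp: dominated_def rank_def thresholds_def intro!: sum.cong)
    moreover have "level (f y) (i, j) \<noteq> level y (i, j)"
      using less.prems(4) same[OF vS] by simp
    ultimately obtain z where "(box_step a b)\<^sup>*\<^sup>* y z" "dominated \<tau> a b z" "rank \<tau> a b z < rank \<tau> a b y"
      using less.hyps yC y_box by blast
    then show ?thesis using rank step by (auto intro: converse_rtranclp_into_rtranclp)
  qed
qed

lemma dominated_reach_settled:
  assumes "\<tau> \<in> {-1, 1}" "dominated \<tau> a b x" "x \<in> C" "x \<in> box a b"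
  shows "\<exists>y. (box_step a b)\<^sup>*\<^sup>* x y \<and> settled a b y"
  using assms(2-)
proof (induction "rank \<tau> a b x" arbitrary: x rule: less_induct)
  case (less x)
  show ?case
  proof (cases "settled a b x")
    case True
    then show ?thesis by blast
  next
    case False
    then obtain i j where "(i, j) \<in> thresholds a b" "level (f x) (i, j) \<noteq> level x (i, j)"
      by (auto simp: settled_def)
    from decrease_rank[OF assms(1) this(1) less.prems this(2)]
    obtain y where y: "(box_step a b)\<^sup>*\<^sup>* x y" "dominated \<tau> a b y" "rank \<tau> a b y < rank \<tau> a b x"
      by blast
    from less.hyps[OF y(3,2) box_reach_C[OF y(1) less.prems(2)] box_reach_box[OF y(1) less.prems(3)]]
    show ?thesis using y(1) by (meson rtranclp_trans)
  qed
qed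

text \<open>
  Thresholds of the same variable may carry opposite values of \<open>\<sigma>\<close>, so climbing along \<open>\<sigma>\<close>
  can get blocked. The induction removes from the box the lowest value of one variable: a state that
  is settled in the smaller box misses at most one threshold, hence is dominated for one of the
  two signs.
\<close>

lemma reach_settled:
  assumes "x \<in> C" "x \<in> box a b"
  shows "\<exists>y. (box_step a b)\<^sup>*\<^sup>* x y \<and> settled a b y"
  using assms
proof (induction "\<Sum>i\<in>{1..n}. nat (b i - a i)" arbitrary: a b x rule: less_induct)
  case (less a b x)
  have size: "(\<Sum>k\<in>{1..n}. nat (b' k - a' k)) < (\<Sum>k\<in>{1..n}. nat (b k - a k))"
    if "i \<in> {1..n}" "\<And>k. a k \<le> a' k" "\<And>k. b' k \<le> b k" "b' i - a' i < b i - a i" "a i < b i" for a' b' i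
  proof (rule sum_strict_mono_ex1)
    show "\<forall>k\<in>{1..n}. nat (b' k - a' k) \<le> nat (b k - a k)"
      by (intro ballI nat_mono diff_mono that(2,3))
    show "\<exists>k\<in>{1..n}. nat (b' k - a' k) < nat (b k - a k)"
      using that(1,4,5) by (intro bexI[of _ i]) auto
  qed simp
  show ?case
  proof (cases "\<exists>i\<in>{1..n}. a i < b i")
    case False
    have "v \<notin> thresholds a b" for v
    proof
      assume "v \<in> thresholds a b"
      then have "v \<in> bool_index n m" "a (fst v) < b (fst v)"
        using S_index by (auto simp: thresholds_def)
      with False show False by (auto simp: bool_index_def)
    qed
    then have "settled a b x" unfolding settled_def by blast
    then show ?thesis by blast
  next
    case True
    then obtain i where i: "i \<in> {1..n}" "a i < b i" by blast
    show ?thesis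
    \<comment> \<open>If coordinate \<open>i\<close> can leave its lowest value, induction applies
      to the box without that value; otherwise it applies to the face where \<open>i\<close> has
      that value.\<close>
    proof (cases "\<exists>y. (box_step a b)\<^sup>*\<^sup>* x y \<and> a i < y i")
      case True
      then obtain y where y: "(box_step a b)\<^sup>*\<^sup>* x y" "a i < y i" by blast
      define a' where "a' = a(i := a i + 1)"
      have "y \<in> box a' b"
        using box_reach_box[OF y(1) less.prems(2)] y(2) by (auto simp: box_def a'_def)
      moreover have "y \<in> C" by (rule box_reach_C[OF y(1) less.prems(1)])
      moreover have "(\<Sum>k\<in>{1..n}. nat (b k - a' k)) < (\<Sum>k\<in>{1..n}. nat (b k - a k))"
        by (rule size[OF i(1) _ _ _ i(2)]) (auto simp: a'_def)
      ultimately obtain z where z: "(box_step a' b)\<^sup>*\<^sup>* y z" "settled a' b z" "z \<in> C" "z \<in> box a' b"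
        using less.hyps[of b a' y] box_reach_C box_reach_box by blast
      have sub: "box a' b \<subseteq> box a b"
        by (rule box_mono) (auto simp: a'_def le_fun_def)
      have xz: "(box_step a b)\<^sup>*\<^sup>* x z"
        using y(1) box_reach_mono[OF sub z(1)] by (rule rtranclp_trans)
      \<comment> \<open>This is the one threshold of the box that the smaller box may miss.\<close>
      define v where "v = (i, nat (a i + 1))"
      have thr: "u \<in> thresholds a' b" if "u \<in> thresholds a b" "u \<noteq> v" for u
        using that by (auto simp: thresholds_def a'_def v_def)
      have eq: "level (f z) u = level z u" if "u \<in> thresholds a b" "u \<noteq> v" for u
        using z(2) thr[OF that] by (simp add: settled_def)
      show ?thesis
      proof (cases "v \<in> thresholds a b \<and> level (f z) v \<noteq> level z v")
        case False
        then have "settled a b z" using eq by (auto simp: settled_def)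
        then show ?thesis using xz by blast
      next
        case True
        then have vS: "v \<in> S" by (auto simp: thresholds_def)
        then have "1 \<le> nat (a i + 1)" using S_index by (auto simp: bool_index_def v_def)
        then have vi: "int (nat (a i + 1)) = a i + 1" by simp
        have "a i + 1 \<le> z i" using box_bounds[OF z(4) i(1)] by (simp add: a'_def)
        then have "level z v = 1" using vi by (simp add: level_def v_def)
        moreover have "level (f z) v \<in> {0, 1}" by (auto simp: level_def)
        ultimately have lv: "level (f z) v = 0" "level z v = 1" using True by auto
        \<comment> \<open>With \<tau> equal to \<open>\<sigma> v\<close>, the factor at
          \<open>v\<close> is 1 and its level 1 lies above its target 0; all other thresholds are at
          equality.\<close>
        have "dominated (\<sigma> v) a b z"
          unfolding dominated_def
        proof
          fix u assume "u \<in> thresholds a b"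
          then show "\<sigma> v * \<sigma> u * level (f z) u \<le> \<sigma> v * \<sigma> u * level z u"
            using eq[of u] lv sigma[OF vS] by (cases "u = v") auto
        qed
        moreover have "z \<in> box a b" using z(4) sub by blast
        ultimately show ?thesis
          using dominated_reach_settled[OF sigma[OF vS] _ z(3)] xz by (meson rtranclp_trans)
      qed
    next
      case False
      define b' where "b' = b(i := a i)"
      have xi: "x i = a i"
        using False box_bounds[OF less.prems(2) i(1)] by fastforce
      have "x \<in> box a b'" using less.prems(2) xi by (auto simp: box_def b'_def)
      moreover have "(\<Sum>k\<in>{1..n}. nat (b' k - a k)) < (\<Sum>k\<in>{1..n}. nat (b k - a k))"
        by (rule size[OF i(1) _ _ _ i(2)]) (use i(2) in \<open>auto simp: b'_def\<close>)
      ultimately obtain y where y: "(box_step a b')\<^sup>*\<^sup>* x y" "settled a b' y" "y \<in> C" "y \<in> box a b'"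
        using less.hyps[of b' a x] less.prems(1) box_reach_C box_reach_box by blast
      have sub: "box a b' \<subseteq> box a b"
        by (rule box_mono) (use i(2) in \<open>auto simp: b'_def le_fun_def\<close>)
      have xy: "(box_step a b)\<^sup>*\<^sup>* x y" by (rule box_reach_mono[OF sub y(1)])
      have yi: "y i = a i" using box_bounds[OF y(4) i(1)] by (simp add: b'_def)
      \<comment> \<open>Otherwise coordinate \<open>i\<close> could move up inside the box, which
        this case excludes.\<close>
      have fyi: "f y i \<le> a i"
      proof (rule ccontr)
        assume "\<not> f y i \<le> a i"
        then have "box_step a b y (shift y 1 i)"
          using yi i y(4) sub by (intro box_stepI[OF y(3) _ i(1)]) (auto simp: shift_def)
        then have "(box_step a b)\<^sup>*\<^sup>* x (shift y 1 i)"
          using xy by (rule rtranclp.rtrancl_into_rtrancl[rotated])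
        then show False using False yi by (auto simp: shift_def)
      qed
      \<comment> \<open>Thresholds of coordinate \<open>i\<close> exceed \<open>a i\<close>, so
        level and target are both 0 there; the others are thresholds of the face.\<close>
      have "settled a b y"
        unfolding settled_def
      proof
        fix v assume v: "v \<in> thresholds a b"
        show "level (f y) v = level y v"
        proof (cases "fst v = i")
          case True
          then have "a i < int (snd v)" using v by (auto simp: thresholds_def)
          then show ?thesis using True yi fyi by (simp add: level_def)
        next
          case False
          then have "v \<in> thresholds a b'" using v by (auto simp: thresholds_def b'_def)
          then show ?thesis using y(2) by (simp add: settled_def)
        qed
      qed
      then show ?thesis using xy by blast
    qed
  qed
qed

lemma level_constant:
  assumes min: "\<And>T. T \<subseteq> C \<Longrightarrow> T \<noteq> {} \<Longrightarrow>
      (\<And>x y. x \<in> T \<Longrightarrow> (x, y) \<in> parcs (async_dynamics n m f) \<Longrightarrow> y \<in> T) \<Longrightarrow> T = C"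
    and "x \<in> C" "y \<in> C" "v \<in> S"
  shows "level x v = level y v"
proof -
  define T where "T = {x \<in> C. \<forall>v\<in>S. level (f x) v = level x v}"
  \<comment> \<open>A crossing in \<open>S\<close> would change a level into its target, but at a
    state of \<open>T\<close> the two already agree.\<close>
  have same: "level z u = level x u \<and> level (f z) u = level (f x) u"
    if xT: "x \<in> T" and xz: "(x, z) \<in> parcs (async_dynamics n m f)" and u: "u \<in> S" for x z u
  proof -
    obtain i s where st: "i \<in> {1..n}" "s = sgn (f x i - x i)" "s \<noteq> 0" "z = shift x s i"
      using xz by (auto simp: async_dynamics_def)
    have x: "x \<in> C" using xT by (simp add: T_def)
    note lv = step_level[OF x st]
    have "(i, nat (max (x i) (z i))) \<notin> S"
    proof
      assume "(i, nat (max (x i) (z i))) \<in> S"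
      then have "level (f x) (i, nat (max (x i) (z i))) = level x (i, nat (max (x i) (z i)))"
        using xT by (simp add: T_def)
      then show False using lv(1,2) st(3) by simp
    qed
    then show ?thesis using lv(3)[OF u] lv(4)[OF u] u by metis
  qed
  \<comment> \<open>The box of all states has every element of \<open>S\<close> among its
    thresholds.\<close>
  have "x \<in> box (\<lambda>_. 0) (\<lambda>i. int (m i))"
    using C_states \<open>x \<in> C\<close> by (auto simp: box_def states_def PiE_iff)
  from reach_settled[OF \<open>x \<in> C\<close> this] obtain z where
    z: "(box_step (\<lambda>_. 0) (\<lambda>i. int (m i)))\<^sup>*\<^sup>* x z" "settled (\<lambda>_. 0) (\<lambda>i. int (m i)) z"
    by blast
  have "thresholds (\<lambda>_. 0) (\<lambda>i. int (m i)) = S"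
    using S_index by (auto simp: thresholds_def bool_index_def)
  then have "z \<in> T" using z box_reach_C[OF z(1) \<open>x \<in> C\<close>] by (auto simp: T_def settled_def)
  have T: "T = C"
  proof (rule min)
    show "T \<subseteq> C" by (auto simp: T_def)
    show "T \<noteq> {}" using \<open>z \<in> T\<close> by blast
    fix u u' assume u: "u \<in> T" "(u, u') \<in> parcs (async_dynamics n m f)"
    then have "u' \<in> C" using C_closed by (auto simp: T_def)
    then show "u' \<in> T" using u(1) same[OF u] by (simp add: T_def)
  qed
  \<comment> \<open>Now that \<open>T = C\<close>, moves in \<open>C\<close> never change the level
    at \<open>v\<close>, so minimality applies a second time.\<close>
  have "{z \<in> C. level z v = level x v} = C"
  proof (rule min)
    show "{z \<in> C. level z v = level x v} \<noteq> {}" using \<open>x \<in> C\<close> by blast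
    fix u u' assume u: "u \<in> {z \<in> C. level z v = level x v}" "(u, u') \<in> parcs (async_dynamics n m f)"
    then show "u' \<in> {z \<in> C. level z v = level x v}"
      using same[OF _ u(2) \<open>v \<in> S\<close>] C_closed[OF _ u(2)] by (simp add: T)
  qed simp
  with \<open>y \<in> C\<close> have "y \<in> {z \<in> C. level z v = level x v}" by (simp only:)
  then show ?thesis by simp
qed

end

section \<open>From moves in the attractor to edges of the interaction graph, and the
  theorem\<close>

text \<open>Crossing threshold \<open>w\<close> by a unit move is the same as flipping the Boolean
  coordinate \<open>w\<close>, so a change of target along the move is an edge of the local graph at
  the image of \<open>x\<close>.\<close>

lemma interaction_graph_arc:
  assumes st: "x \<in> S" "S \<subseteq> states n m" "i \<in> {1..n}" "s \<in> {-1, 1}" "y = shift x s i" "y \<in> states n m"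
    and v: "v \<in> bool_index n m" "level (f y) v \<noteq> level (f x) v"
  defines "w \<equiv> (i, nat (max (x i) (y i)))"
  shows "w \<in> bool_index n m" "level y w \<noteq> level x w"
    "(w, s * sgn (level (f y) v - level (f x) v), v) \<in> arcs (interaction_graph (bool_index n m)
      (admissible n m) (bool_map n m f) (beta n m ` S))"
proof -
  have x: "x \<in> states n m" using st(1,2) by blast
  have rng: "0 \<le> x i" "x i \<le> int (m i)" "0 \<le> y i" "y i \<le> int (m i)"
    using x st(3,6) by (auto simp: states_def PiE_iff)
  have yi: "y i = x i + s" using st(5) by (simp add: shift_def)
  show w: "w \<in> bool_index n m"
    using rng yi st(3,4) by (auto simp: w_def bool_index_def)
  show "level y w \<noteq> level x w"
    using rng yi st(4) by (auto simp: level_def w_def)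
  have bm: "bool_map n m f (beta n m u) = beta n m (f u)" if "u \<in> states n m" for u
    using that by (simp add: bool_map_def the_inv_into_f_f[OF inj_on_beta])
  have "level y u = (if u = w then level x u + s else level x u)" if "u \<in> bool_index n m" for u
    using that rng yi st(4,5)
    by (cases u) (auto simp: level_def w_def shift_def bool_index_def)
  \<comment> \<open>Outside the index set both sides are the default value of a restricted
    function.\<close>
  then have "shift (beta n m x) s w u = beta n m y u" for u
    using w by (cases "u \<in> bool_index n m") (auto simp: shift_def beta_eq_level, auto simp: beta_def)
  then have shift_eq: "shift (beta n m x) s w = beta n m y" ..
  have "beta n m y \<in> admissible n m" using st(6) by (simp add: admissible_def)
  then have "(w, s * sgn (level (f y) v - level (f x) v), v)
      \<in> arcs (local_interaction_graph (bool_index n m) (admissible n m) (bool_map n m f) (beta n m x))"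
    using st(4) v w unfolding local_interaction_graph_def signed_graph_def
    by (simp del: split_paired_Ex)
      (intro exI[of _ w] exI[of _ v] exI[of _ s] conjI;
        auto simp: shift_eq bm[OF x] bm[OF st(6)] beta_eq_level sgn_0_0)
  then show "(w, s * sgn (level (f y) v - level (f x) v), v) \<in> arcs (interaction_graph (bool_index n m)
      (admissible n m) (bool_map n m f) (beta n m ` S))"
    using st(1) by (auto simp: interaction_graph_def signed_graph_def)
qed

lemma interaction_graph_edge_sign:
  assumes "e \<in> arcs (interaction_graph J Y g S)"
  shows "edge_sign e \<in> {-1, 1}"
proof -
  have "s * sgn c \<in> {-1, 1}" if "s \<in> {-1, 1}" "s * sgn c \<noteq> 0" for s c :: int
    using that by (auto simp: sgn_if)
  with assms show ?thesis
    unfolding interaction_graph_def local_interaction_graph_def signed_graph_def by fastforce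
qed

theorem theorem10:
  fixes n :: nat and m :: "nat \<Rightarrow> nat"
    and f :: "nat ivec \<Rightarrow> nat ivec" and C :: "nat ivec set"
  assumes "\<And>i. i \<in> {1..n} \<Longrightarrow> 1 \<le> m i"
    and "f \<in> states n m \<rightarrow> states n m"
    and "cyclic_attractor (async_dynamics n m f) C"
  shows "\<exists>p. negative_cycle
    (interaction_graph (bool_index n m) (admissible n m) (bool_map n m f) (beta n m ` C)) p"
proof (rule ccontr)
  define G where "G = interaction_graph (bool_index n m) (admissible n m) (bool_map n m f) (beta n m ` C)"
  assume "\<nexists>p. negative_cycle
    (interaction_graph (bool_index n m) (admissible n m) (bool_map n m f) (beta n m ` C)) p"
  then have no_neg: "\<nexists>p. negative_cycle G p" by (simp add: G_def)
  have trap: "trap_set (async_dynamics n m f) C"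
    and min: "\<And>T. trap_set (async_dynamics n m f) T \<Longrightarrow> T \<subseteq> C \<Longrightarrow> T = C"
    using assms(3) by (auto simp: cyclic_attractor_def attractor_def)
  have C: "C \<subseteq> states n m"
    using trap by (auto simp: trap_set_def async_dynamics_def)
  have closed: "y \<in> C" if "x \<in> C" "(x, y) \<in> parcs (async_dynamics n m f)" for x y
    using trap that by (auto simp: trap_set_def)
  define V where "V = {v \<in> bool_index n m. \<exists>x\<in>C. \<exists>y\<in>C. level x v \<noteq> level y v}"
  \<comment> \<open>Edges of \<open>G\<close> may come from neighbours outside the image of
    \<open>C\<close>, with sources outside \<open>V\<close>. They are dropped, since moves in
    \<open>C\<close> cross only thresholds in \<open>V\<close>.\<close>
  define H where "H = signed_graph V {e \<in> arcs G. fst e \<in> V \<and> snd (snd e) \<in> V}"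
  have compat: "compatible G H"
    by (simp add: compatible_def G_def H_def interaction_graph_def signed_graph_def)
  interpret H: wf_digraph H
    by unfold_locales (auto simp: H_def signed_graph_def)
  \<comment> \<open>\<open>G\<close> and \<open>H\<close> share their tail and head maps, so a cycle
    of the subgraph is a cycle of \<open>G\<close> with the same sign.\<close>
  have "negative_cycle G p" if "H.cycle p" "prod_list (map edge_sign p) = -1" for p
    using that compatible_cas[OF compat] compatible_awalk_verts[OF compat]
    unfolding negative_cycle_def H.cycle_def pre_digraph.cycle_def H.awalk_def pre_digraph.awalk_def
    by (fastforce simp: H_def G_def V_def signed_graph_def interaction_graph_def)
  then have no_neg_H: "\<nexists>p. H.cycle p \<and> prod_list (map edge_sign p) = -1"
    using no_neg by blast
  have V_ne: "V \<noteq> {}"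
  proof -
    obtain x y where xy: "x \<in> C" "y \<in> C" "x \<noteq> y"
      using assms(3) by (auto simp: cyclic_attractor_def)
    then have "beta n m x \<noteq> beta n m y"
      using C by (metis inj_on_beta inj_onD subsetD)
    then obtain v where "beta n m x v \<noteq> beta n m y v" by blast
    moreover from this have "v \<in> bool_index n m" by (rule contrapos_np) (simp add: beta_def)
    ultimately have "v \<in> V" using xy(1,2) unfolding V_def by (auto simp only: beta_eq_level mem_Collect_eq)
    then show ?thesis by blast
  qed
  have V_fin: "finite V"
    by (rule finite_subset[OF _ finite_bool_index]) (auto simp: V_def)
  have sg: "edge_sign e \<in> {-1, 1}" if "e \<in> arcs H" for e
    by (rule interaction_graph_edge_sign) (use that in \<open>auto simp: H_def G_def signed_graph_def\<close>)
  have verts_H: "verts H = V" by (simp add: H_def signed_graph_def)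
  obtain S \<sigma> where S: "S \<subseteq> V" "S \<noteq> {}" "\<And>v. v \<in> S \<Longrightarrow> \<sigma> v \<in> {-1, 1 :: int}"
    and bal: "\<And>e. e \<in> arcs H \<Longrightarrow> head H e \<in> S \<Longrightarrow>
      tail H e \<in> S \<and> edge_sign e = \<sigma> (tail H e) * \<sigma> (head H e)"
    using H.exists_balanced_predecessor_closed[of edge_sign, unfolded verts_H, OF V_fin V_ne sg no_neg_H]
    by metis
  interpret balanced_trap n m f C S \<sigma>
  proof
    show "C \<subseteq> states n m" by (rule C)
    show "S \<subseteq> bool_index n m" using S(1) by (auto simp: V_def)
    fix x i s y v
    assume st: "x \<in> C" "i \<in> {1..n}" "s = sgn (f x i - x i)" "s \<noteq> 0" "y = shift x s i"
      and v: "v \<in> S" "level (f y) v \<noteq> level (f x) v"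
    let ?w = "(i, nat (max (x i) (y i)))"
    have "(x, y) \<in> parcs (async_dynamics n m f)"
      using st C by (auto simp: async_dynamics_def)
    then have y: "y \<in> C" by (rule closed[OF st(1)])
    have s: "s \<in> {-1, 1}" using st(3,4) by (auto simp: sgn_if split: if_splits)
    have vV: "v \<in> V" using v(1) S(1) by blast
    have "v \<in> bool_index n m" "y \<in> states n m" using vV y C by (auto simp: V_def)
    note arc = interaction_graph_arc[OF st(1) C st(2) s st(5) this(2,1) v(2), folded G_def]
    \<comment> \<open>Both ends of the move lie in \<open>C\<close> and witness that
      \<open>?w\<close> is crossed there.\<close>
    have "?w \<in> V" using arc(1,2) st(1) y by (auto simp: V_def)
    then have "(?w, s * sgn (level (f y) v - level (f x) v), v) \<in> arcs H"
      using arc(3) vV by (simp add: H_def signed_graph_def)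
    from bal[OF this] v(1) show "?w \<in> S \<and> s * sgn (level (f y) v - level (f x) v) = \<sigma> ?w * \<sigma> v"
      by (simp add: H_def signed_graph_def)
  qed (use closed S(3) in auto)
  obtain v x y where "v \<in> S" "x \<in> C" "y \<in> C" "level x v \<noteq> level y v"
    using S(1,2) unfolding V_def by blast
  moreover have "T = C" if "T \<subseteq> C" "T \<noteq> {}"
    "\<And>x y. x \<in> T \<Longrightarrow> (x, y) \<in> parcs (async_dynamics n m f) \<Longrightarrow> y \<in> T" for T
    using that C by (intro min) (auto simp: trap_set_def async_dynamics_def)
  ultimately show False using level_constant by blast
qed

end
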